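(* Let $\hat{\mathbf x}_1,\hat{\mathbf x}_2,\hat{\mathbf x}_3$ be three finite points of $\mathrm P\mathbb R^2$ and $\mathbf l_1,\mathbf l_2$ two lines of $\mathrm P\mathbb R^2$ such that the three points and two lines are in general position, $\hat{\mathbf x}_3^T\mathbf l_1=0$, and $\hat{\mathbf x}_1,\hat{\mathbf x}_2,\mathbf p=\mathbf l_1\times\mathbf l_2$ are not collinear. Then the problem of determining a non-degenerate conic $\mathbf C$ such that $\hat{\mathbf x}_i^T\mathbf C\hat{\mathbf x}_i=0$ for $i=1,2,3$ and $\mathbf l_j^T\mathbf C^{-1}\mathbf l_j=0$ for $j=1,2$ has two distinct real solutions if and only if $$\det([\mathbf p,\hat{\mathbf x}_2,\hat{\mathbf x}_3])\,\det([\hat{\mathbf x}_1,\mathbf p,\hat{\mathbf x}_3])\,(\hat{\mathbf x}_1^T\mathbf l_2)(\hat{\mathbf x}_2^T\mathbf l_2)<0.$$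
   Context: $\mathrm P\mathbb R^2$ is the real projective plane. A hat denotes a finite point in normalized homogeneous coordinates, i.e. a vector of $\mathbb R^3$ whose third component is $1$. A line is given by a nonzero vector $\mathbf l\in\mathbb R^3$ (up to scale), and $\mathbf x$ lies on $\mathbf l$ iff $\mathbf x^T\mathbf l=0$; the two lines are distinct and the cross product $\mathbf l_1\times\mathbf l_2$ is their intersection point. $[\mathbf a,\mathbf b,\mathbf c]$ is the $3\times3$ matrix with columns $\mathbf a,\mathbf b,\mathbf c$. A side of a triangle is the full line through two of its vertices. Three points and two lines are in general position if the three points are non-collinear, neither $\mathbf l_1$ nor $\mathbf l_2$ is a side of the triangle $\hat{\mathbf x}_1\hat{\mathbf x}_2\hat{\mathbf x}_3$, and the intersection point of $\mathbf l_1$ and $\mathbf l_2$ is not a vertex of that triangle. A conic is a nonzero symmetric $3\times3$ matrix (complex entries allowed) up to nonzero scale; it is non-degenerate if its determinant is nonzero and real if it can be represented by a real matrix. Solutions are counted up to scale. *)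

theory Defs
  imports "HOL-Analysis.Analysis"
begin

text \<open>
  A point or a line of the real projective plane is a nonzero vector of \<^typ>\<open>real^3\<close>,
  up to a nonzero factor.
\<close>

definition same_proj :: "real^3 \<Rightarrow> real^3 \<Rightarrow> bool" where
  "same_proj u v \<longleftrightarrow> (\<exists>c. c \<noteq> 0 \<and> v = c *\<^sub>R u)"

definition incident :: "real^3 \<Rightarrow> real^3 \<Rightarrow> bool" where
  "incident x l \<longleftrightarrow> x \<bullet> l = 0"

definition proj_collinear :: "real^3 \<Rightarrow> real^3 \<Rightarrow> real^3 \<Rightarrow> bool" where
  "proj_collinear x y z \<longleftrightarrow> (\<exists>l. l \<noteq> 0 \<and> incident x l \<and> incident y l \<and> incident z l)"

definition finite_point :: "real^3 \<Rightarrow> bool" where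
  "finite_point x \<longleftrightarrow> x $ 3 = 1"

definition is_side :: "real^3 \<Rightarrow> real^3 \<Rightarrow> real^3 \<Rightarrow> real^3 \<Rightarrow> bool" where
  "is_side l x1 x2 x3 \<longleftrightarrow>
     incident x1 l \<and> incident x2 l \<or> incident x1 l \<and> incident x3 l \<or> incident x2 l \<and> incident x3 l"

definition is_vertex :: "real^3 \<Rightarrow> real^3 \<Rightarrow> real^3 \<Rightarrow> real^3 \<Rightarrow> bool" where
  "is_vertex p x1 x2 x3 \<longleftrightarrow> same_proj p x1 \<or> same_proj p x2 \<or> same_proj p x3"

definition general_position ::
    "real^3 \<Rightarrow> real^3 \<Rightarrow> real^3 \<Rightarrow> real^3 \<Rightarrow> real^3 \<Rightarrow> bool" where
  "general_position x1 x2 x3 l1 l2 \<longleftrightarrow>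
     \<not> proj_collinear x1 x2 x3 \<and>
     \<not> is_side l1 x1 x2 x3 \<and> \<not> is_side l2 x1 x2 x3 \<and>
     \<not> is_vertex (cross3 l1 l2) x1 x2 x3"

definition of_columns :: "real^3 \<Rightarrow> real^3 \<Rightarrow> real^3 \<Rightarrow> real^3^3" where
  "of_columns a b c = transpose (vector [a, b, c])"

definition cvec :: "real^3 \<Rightarrow> complex^3" where
  "cvec x = (\<chi> i. complex_of_real (x $ i))"

text \<open>
  The form \<open>v\<^sup>T M v\<close>, without conjugation. The library's \<open>\<bullet>\<close> on
  \<^typ>\<open>complex^3\<close> is a real-valued inner product and would be wrong here.
\<close>

definition quad_form :: "complex^3^3 \<Rightarrow> complex^3 \<Rightarrow> complex" where
  "quad_form M v = (\<Sum>i\<in>UNIV. v $ i * (M *v v) $ i)"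

definition conic_matrix :: "complex^3^3 \<Rightarrow> bool" where
  "conic_matrix C \<longleftrightarrow> C \<noteq> 0 \<and> transpose C = C"

text \<open>A conic is an equivalence class of this relation.\<close>

definition conic_rel :: "(complex^3^3) rel" where
  "conic_rel = {(C, D). conic_matrix C \<and> conic_matrix D \<and> (\<exists>c. c \<noteq> 0 \<and> D = map_matrix ((*) c) C)}"

definition real_conic :: "(complex^3^3) set \<Rightarrow> bool" where
  "real_conic K \<longleftrightarrow> (\<exists>R :: real^3^3. map_matrix complex_of_real R \<in> K)"

definition solution_matrix ::
    "real^3 \<Rightarrow> real^3 \<Rightarrow> real^3 \<Rightarrow> real^3 \<Rightarrow> real^3 \<Rightarrow> complex^3^3 \<Rightarrow> bool" where
  "solution_matrix x1 x2 x3 l1 l2 C \<longleftrightarrow>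
     conic_matrix C \<and> det C \<noteq> 0 \<and>
     (\<forall>x\<in>{x1, x2, x3}. quad_form C (cvec x) = 0) \<and>
     (\<forall>l\<in>{l1, l2}. quad_form (matrix_inv C) (cvec l) = 0)"

definition solution_conics ::
    "real^3 \<Rightarrow> real^3 \<Rightarrow> real^3 \<Rightarrow> real^3 \<Rightarrow> real^3 \<Rightarrow> (complex^3^3) set set" where
  "solution_conics x1 x2 x3 l1 l2 = {C. solution_matrix x1 x2 x3 l1 l2 C} // conic_rel"

lemma equiv_conic_rel: "equiv {C. conic_matrix C} conic_rel"
proof (rule equivI)
  show "conic_rel \<subseteq> {C. conic_matrix C} \<times> {C. conic_matrix C}"
    by (auto simp: conic_rel_def)
  show "refl_on {C. conic_matrix C} conic_rel"
    by (auto simp: refl_on_def conic_rel_def map_matrix_def vec_eq_iff intro!: exI[of _ 1])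
  show "sym conic_rel"
  proof (rule symI)
    fix C D assume "(C, D) \<in> conic_rel"
    then obtain c where c: "conic_matrix C" "conic_matrix D" "c \<noteq> 0" "D = map_matrix ((*) c) C"
      by (auto simp: conic_rel_def)
    have "C = map_matrix ((*) (inverse c)) D"
      using c by (simp add: map_matrix_def vec_eq_iff)
    moreover have "inverse c \<noteq> 0"
      using c by simp
    ultimately show "(D, C) \<in> conic_rel"
      using c(1,2) unfolding conic_rel_def by blast
  qed
  show "trans conic_rel"
  proof (rule transI)
    fix C D E assume "(C, D) \<in> conic_rel" "(D, E) \<in> conic_rel"
    then obtain c d where c: "conic_matrix C" "conic_matrix E" "c \<noteq> 0" "d \<noteq> 0"
      "D = map_matrix ((*) c) C" "E = map_matrix ((*) d) D"
      by (auto simp: conic_rel_def)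
    have "E = map_matrix ((*) (d * c)) C"
      using c by (simp add: map_matrix_def vec_eq_iff)
    moreover have "d * c \<noteq> 0"
      using c by simp
    ultimately show "(C, E) \<in> conic_rel"
      using c(1,2) unfolding conic_rel_def by blast
  qed
qed

end

theory Submission
  imports Defs
begin

text \<open>
  Since the three points are not collinear, they are the images of the standard basis vectors under
  the invertible matrix \<open>X = [x1, x2, x3]\<close>, and the substitution \<open>C \<mapsto> X\<^sup>T C X\<close>, \<open>l \<mapsto> X\<^sup>T l\<close>
  reduces the problem to the reference triangle (\<open>solution_matrix_congr\<close>). There the conics through
  the vertices are the symmetric matrices with zero diagonal; let \<open>a, b, c\<close> be their entries at the
  positions (1,2), (1,3), (2,3). The determinant is \<open>2abc\<close>, and if it is nonzero, the line \<open>(u, v, w)\<close> is tangent iff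
  \<open>(wa - (cu + bv))\<^sup>2 = 4bcuv\<close> (\<open>tangent_triangle_conic\<close>).

  The first line passes through the third vertex, so \<open>w1 = 0\<close>, and its tangency condition becomes
  the perfect square \<open>(c u1 - b v1)\<^sup>2 = 0\<close>. Hence \<open>(b, c)\<close> is proportional to \<open>(u1, v1)\<close>; the
  normalization \<open>(b, c) = (u1, v1)\<close> fixes the scale and leaves \<open>a\<close> as the only unknown. The second line gives
  \<open>(w2 a - (v1 u2 + u1 v2))\<^sup>2 = 4 u1 v1 u2 v2\<close>
  (\<open>solution_matrix_reference_triangle\<close>). Here \<open>w2 \<noteq> 0\<close> because \<open>p\<close> is not the vertex \<open>x3\<close>, and \<open>a = 0\<close> is
  not a root because \<open>x1, x2, p\<close> are not collinear, so no root has to be discarded as degenerate.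
  Because of the normalization, distinct roots give distinct conics, and a conic is real iff its root
  is real, so that real solutions are counted by real roots (\<open>card_real_solution_conics\<close>). So there are two real solutions iff \<open>u1 v1 u2 v2 > 0\<close>. The two
  determinants of the criterion are \<open>v1 w2\<close> and \<open>- u1 w2\<close>, so that its left-hand side is
  \<open>- w2\<^sup>2 u1 v1 u2 v2\<close>.
\<close>

section \<open>Conics under change of coordinates\<close>

(* By default the simplifier rewrites transpose A *v x to x v* A, which hides the congruences below. *)
declare transpose_matrix_vector [simp del]

abbreviation cmat :: "real^3^3 \<Rightarrow> complex^3^3" where
  "cmat \<equiv> map_matrix complex_of_real"

abbreviation scale_mat :: "complex \<Rightarrow> complex^3^3 \<Rightarrow> complex^3^3" where
  "scale_mat s \<equiv> map_matrix ((*) s)"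

abbreviation congr :: "complex^3^3 \<Rightarrow> complex^3^3 \<Rightarrow> complex^3^3" where
  "congr P C \<equiv> transpose P ** C ** P"

lemma congr_scale: "congr P (scale_mat s C) = scale_mat s (congr P C)"
  by (simp add: vec_eq_iff matrix_matrix_mult_def map_matrix_def sum_distrib_left
      sum_distrib_right algebra_simps)

lemma congr_cancel:
  assumes "P ** Q = mat 1"
  shows "congr Q (congr P C) = C"
proof -
  have "transpose Q ** transpose P = mat 1"
    by (metis assms matrix_transpose_mul transpose_mat)
  then show ?thesis
    by (metis assms matrix_mul_assoc matrix_mul_lid matrix_mul_rid)
qed

lemma cmat_mult: "cmat A ** cmat B = cmat (A ** B)"
  by (simp add: vec_eq_iff matrix_matrix_mult_def)

lemma det_cmat: "det (cmat A) = complex_of_real (det A)"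
  by (simp add: det_3)

lemma cmat_one: "cmat (mat 1) = mat 1"
  by (simp add: vec_eq_iff mat_def)

lemma cmat_mult_cvec: "cmat A *v cvec x = cvec (A *v x)"
  by (simp add: vec_eq_iff matrix_vector_mult_def cvec_def)

lemma transpose_cmat: "transpose (cmat A) = cmat (transpose A)"
  by (simp add: vec_eq_iff transpose_def)

lemma congr_cmat: "congr (cmat P) (cmat C) = cmat (transpose P ** C ** P)"
  by (simp add: cmat_mult transpose_cmat)

text \<open>
  The adjointness \<open>v\<^sup>T (P\<^sup>T w) = (P v)\<^sup>T w\<close>, for the bilinear pairing without conjugation.
\<close>

lemma sum_mult_transpose:
  fixes P :: "complex^3^3"
  shows "(\<Sum>i\<in>UNIV. v $ i * (transpose P *v w) $ i) = (\<Sum>i\<in>UNIV. (P *v v) $ i * w $ i)"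
  by (simp add: matrix_vector_mult_def transpose_def sum_3 algebra_simps)

lemma quad_form_congr: "quad_form (congr P C) v = quad_form C (P *v v)"
proof -
  have "congr P C *v v = transpose P *v (C *v (P *v v))"
    by (simp add: matrix_vector_mul_assoc matrix_mul_assoc)
  then show ?thesis
    by (simp add: quad_form_def sum_mult_transpose)
qed

lemma matrix_inv_mult:
  fixes C :: "'a::field^'n^'n"
  assumes "det C \<noteq> 0"
  shows "C ** matrix_inv C = mat 1" "matrix_inv C ** C = mat 1"
proof -
  have "\<exists>B. C ** B = mat 1 \<and> B ** C = mat 1"
    using assms invertible_det_nz invertible_def by blast
  then have "C ** matrix_inv C = mat 1 \<and> matrix_inv C ** C = mat 1"
    unfolding matrix_inv_def by (rule someI_ex)
  then show "C ** matrix_inv C = mat 1" "matrix_inv C ** C = mat 1"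
    by auto
qed

text \<open>
  If \<open>y\<close> is the pole of the line \<open>l\<close>, then the dual form at \<open>l\<close> is the incidence of \<open>y\<close> with \<open>l\<close>.
  This avoids computing an inverse or an adjugate matrix.
\<close>

lemma quad_form_matrix_inv:
  assumes "det C \<noteq> 0" "C *v y = l"
  shows "quad_form (matrix_inv C) l = (\<Sum>i\<in>UNIV. l $ i * y $ i)"
proof -
  have "matrix_inv C *v l = y"
    using assms matrix_inv_mult(2)[OF assms(1)]
    by (metis matrix_vector_mul_assoc matrix_vector_mul_lid)
  then show ?thesis by (simp add: quad_form_def)
qed

text \<open>
  The pole of \<open>P\<^sup>T l\<close> with respect to \<open>P\<^sup>T C P\<close> is the preimage under \<open>P\<close> of the pole of \<open>l\<close> with respect
  to \<open>C\<close>; incidence of pole and line does not depend on the coordinates.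
\<close>

lemma quad_form_matrix_inv_congr:
  assumes P: "det P \<noteq> 0" and C: "det C \<noteq> 0"
  shows "quad_form (matrix_inv (congr P C)) (transpose P *v l) = quad_form (matrix_inv C) l"
proof -
  define y where "y = matrix_inv C *v l"
  define z where "z = matrix_inv P *v y"
  have y: "C *v y = l"
    by (simp add: y_def matrix_vector_mul_assoc matrix_inv_mult[OF C])
  have z: "P *v z = y"
    by (simp add: z_def matrix_vector_mul_assoc matrix_inv_mult[OF P])
  have "congr P C *v z = transpose P *v l"
    by (simp add: y z flip: matrix_vector_mul_assoc)
  moreover have "det (congr P C) \<noteq> 0"
    using P C by (simp add: det_mul det_transpose)
  ultimately have "quad_form (matrix_inv (congr P C)) (transpose P *v l)
      = (\<Sum>i\<in>UNIV. (transpose P *v l) $ i * z $ i)"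
    by (rule quad_form_matrix_inv[rotated])
  also have "\<dots> = (\<Sum>i\<in>UNIV. l $ i * (P *v z) $ i)"
    using sum_mult_transpose[of z P l] by (simp add: mult.commute)
  also have "\<dots> = quad_form (matrix_inv C) l"
    using quad_form_matrix_inv[OF C y] z by simp
  finally show ?thesis .
qed

lemma conic_matrix_congr:
  assumes "det P \<noteq> 0"
  shows "conic_matrix (congr P C) \<longleftrightarrow> conic_matrix C"
proof -
  have imp: "conic_matrix (congr P C)" if "conic_matrix C" "P ** Q = mat 1" for P Q C
  proof -
    have "congr P C \<noteq> 0"
      using congr_cancel[OF that(2), of C] that(1)
      by (auto simp: conic_matrix_def)
    then show ?thesis
      using that(1) by (simp add: conic_matrix_def matrix_transpose_mul matrix_mul_assoc)
  qed
  note inv = matrix_inv_mult[OF assms]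
  show ?thesis
    using imp[OF _ inv(1)] imp[OF _ inv(2), of "congr P C"] congr_cancel[OF inv(1), of C] by auto
qed

text \<open>
  Points transform by \<open>P\<close>, lines by \<open>P\<^sup>T\<close> and conics by congruence, so the three points may be moved to
  the reference triangle.
\<close>

lemma solution_matrix_congr:
  assumes "det P \<noteq> 0"
  shows "solution_matrix (P *v y1) (P *v y2) (P *v y3) l1 l2 C \<longleftrightarrow>
    solution_matrix y1 y2 y3 (transpose P *v l1) (transpose P *v l2) (congr (cmat P) C)"
proof -
  have P: "det (cmat P) \<noteq> 0" using assms by (simp add: det_cmat)
  have det: "det (congr (cmat P) C) \<noteq> 0 \<longleftrightarrow> det C \<noteq> 0"
    using P by (simp add: det_mul det_transpose)
  have tangent: "quad_form (matrix_inv (congr (cmat P) C)) (cvec (transpose P *v l))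
      = quad_form (matrix_inv C) (cvec l)" if "det C \<noteq> 0" for l
    using quad_form_matrix_inv_congr[OF P that, of "cvec l"]
    by (simp add: transpose_cmat cmat_mult_cvec)
  show ?thesis
    unfolding solution_matrix_def conic_matrix_congr[OF P] det
    using tangent by (auto simp: quad_form_congr cmat_mult_cvec)
qed

section \<open>Conics circumscribed about the reference triangle\<close>

definition triangle_conic :: "complex \<Rightarrow> complex \<Rightarrow> complex \<Rightarrow> complex^3^3" where
  "triangle_conic a b c = vector [vector [0, a, b], vector [a, 0, c], vector [b, c, 0]]"

lemma det_triangle_conic: "det (triangle_conic a b c) = 2 * a * b * c"
  by (simp add: triangle_conic_def det_3)

lemma scale_triangle_conic: "scale_mat s (triangle_conic a b c) = triangle_conic (s*a) (s*b) (s*c)"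
  by (simp add: triangle_conic_def vec_eq_iff forall_3 map_matrix_def)

lemma triangle_conic_eq_iff:
  "triangle_conic a b c = triangle_conic a' b' c' \<longleftrightarrow> a = a' \<and> b = b' \<and> c = c'"
  by (auto simp: triangle_conic_def vec_eq_iff forall_3)

text \<open>
  The tangency condition of a line is usually written
  \<open>c\<^sup>2u\<^sup>2 + b\<^sup>2v\<^sup>2 + a\<^sup>2w\<^sup>2 = 2bcuv + 2acuw + 2abvw\<close>. Completing the square in \<open>a\<close> isolates the unknown
  that remains once \<open>b\<close> and \<open>c\<close> are known.
\<close>

lemma tangent_triangle_conic:
  assumes "a \<noteq> 0" "b \<noteq> 0" "c \<noteq> 0"
  shows "quad_form (matrix_inv (triangle_conic a b c)) m = 0 \<longleftrightarrow>
    (m $ 3 * a - (c * m $ 1 + b * m $ 2))\<^sup>2 = 4 * b * c * m $ 1 * m $ 2"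
proof -
  have det: "det (triangle_conic a b c) \<noteq> 0"
    using assms by (simp add: det_triangle_conic)
  define y where "y = matrix_inv (triangle_conic a b c) *v m"
  have y: "triangle_conic a b c *v y = m"
    by (simp add: y_def matrix_vector_mul_assoc matrix_inv_mult[OF det])
  have m: "m $ 1 = a * y $ 2 + b * y $ 3" "m $ 2 = a * y $ 1 + c * y $ 3"
    "m $ 3 = b * y $ 1 + c * y $ 2"
    unfolding y[symmetric]
    by (simp_all add: triangle_conic_def matrix_vector_mult_def sum_3)
  (* Writing m as the polar of its pole y turns the claim into a polynomial identity in y. *)
  have "2 * a * b * c * quad_form (matrix_inv (triangle_conic a b c)) m
      = 4 * b * c * m $ 1 * m $ 2 - (m $ 3 * a - (c * m $ 1 + b * m $ 2))\<^sup>2"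
    unfolding quad_form_matrix_inv[OF det y] sum_3 m by algebra
  then show ?thesis
    using assms by auto
qed

lemma quad_form_axis: "quad_form C (cvec (axis k 1)) = C $ k $ k"
proof -
  have "cvec (axis k 1) = axis k 1"
    by (simp add: cvec_def axis_def vec_eq_iff)
  then show ?thesis
    by (simp add: quad_form_def matrix_vector_mul_component inner_axis axis_def
      matrix_vector_mult_def if_distrib if_distribR cong: if_cong)
qed

lemma circumscribed_iff:
  "conic_matrix C \<and> det C \<noteq> 0 \<and> (\<forall>k. quad_form C (cvec (axis k 1)) = 0) \<longleftrightarrow>
    (\<exists>a b c. a \<noteq> 0 \<and> b \<noteq> 0 \<and> c \<noteq> 0 \<and> C = triangle_conic a b c)"
  (is "?L \<longleftrightarrow> ?R")
proof
  assume L: ?L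
  then have "transpose C $ i $ j = C $ i $ j" "C $ i $ i = 0" for i j
    by (simp_all add: conic_matrix_def quad_form_axis)
  then have "C $ j $ i = C $ i $ j" "C $ i $ i = 0" for i j
    by (simp_all add: transpose_def)
  then have C: "C = triangle_conic (C $ 1 $ 2) (C $ 1 $ 3) (C $ 2 $ 3)"
    unfolding vec_eq_iff forall_3 triangle_conic_def vector_3 by blast
  then have "det C = 2 * C $ 1 $ 2 * C $ 1 $ 3 * C $ 2 $ 3"
    by (metis det_triangle_conic)
  with L have "C $ 1 $ 2 \<noteq> 0" "C $ 1 $ 3 \<noteq> 0" "C $ 2 $ 3 \<noteq> 0"
    by auto
  with C show ?R by blast
next
  assume ?R
  then obtain a b c where *: "a \<noteq> 0" "b \<noteq> 0" "c \<noteq> 0" "C = triangle_conic a b c"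
    by blast
  have "det C \<noteq> 0" using * by (simp add: det_triangle_conic)
  moreover from this have "C \<noteq> 0" by (auto simp: det_3)
  moreover have "transpose C = C" "\<forall>k. quad_form C (cvec (axis k 1)) = 0"
    by (simp_all add: * triangle_conic_def vec_eq_iff forall_3 quad_form_axis transpose_def)
  ultimately show ?L by (simp add: conic_matrix_def)
qed

text \<open>
  The first line passes through the third vertex and touches the conic, so it is the tangent there;
  this determines the ratio of \<open>b\<close> and \<open>c\<close>. Normalizing them to the coordinates of the first line, a
  solution is given by a scale factor \<open>s\<close> and a root \<open>t\<close> of the quadratic equation of the second line.
  The last assumption says that \<open>t = 0\<close> is not a root.
\<close>

lemma solution_matrix_reference_triangle:
  fixes m1 m2 :: "real^3"
  assumes m1: "m1 $ 3 = 0" "m1 $ 1 \<noteq> 0" "m1 $ 2 \<noteq> 0"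
    and ne: "m1 $ 2 * m2 $ 1 \<noteq> m1 $ 1 * m2 $ 2"
  shows "solution_matrix (axis 1 1) (axis 2 1) (axis 3 1) m1 m2 C \<longleftrightarrow>
    (\<exists>(t::complex) s. s \<noteq> 0 \<and>
      (m2 $ 3 * t - (m1 $ 2 * m2 $ 1 + m1 $ 1 * m2 $ 2))\<^sup>2
        = complex_of_real (4 * m1 $ 1 * m1 $ 2 * m2 $ 1 * m2 $ 2) \<and>
      C = scale_mat s (triangle_conic t (m1 $ 1) (m1 $ 2)))"
  (is "_ \<longleftrightarrow> (\<exists>t s. s \<noteq> 0 \<and> ?Q t \<and> _)")
proof -
  let ?u1 = "complex_of_real (m1 $ 1)" and ?v1 = "complex_of_real (m1 $ 2)"
  let ?u = "complex_of_real (m2 $ 1)" and ?v = "complex_of_real (m2 $ 2)"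
    and ?w = "complex_of_real (m2 $ 3)"
  have solution: "solution_matrix (axis 1 1) (axis 2 1) (axis 3 1) m1 m2 C \<longleftrightarrow>
    (\<exists>a b c. a \<noteq> 0 \<and> b \<noteq> 0 \<and> c \<noteq> 0 \<and> C = triangle_conic a b c \<and>
       c * ?u1 = b * ?v1 \<and> (?w * a - (c * ?u + b * ?v))\<^sup>2 = 4 * b * c * ?u * ?v)"
    (is "_ \<longleftrightarrow> ?M")
  proof -
    (* The first line has w = 0, and its tangency condition is a perfect square. *)
    have double: "(c * ?u1 + b * ?v1)\<^sup>2 = 4 * b * c * ?u1 * ?v1 \<longleftrightarrow> c * ?u1 = b * ?v1" for b c
    proof -
      have "(c * ?u1 + b * ?v1)\<^sup>2 - 4 * b * c * ?u1 * ?v1 = (c * ?u1 - b * ?v1)\<^sup>2"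
        by algebra
      then show ?thesis
        by (metis eq_iff_diff_eq_0 zero_eq_power2)
    qed
    have tangents: "(\<forall>l\<in>{m1, m2}. quad_form (matrix_inv C) (cvec l) = 0) \<longleftrightarrow>
        c * ?u1 = b * ?v1 \<and> (?w * a - (c * ?u + b * ?v))\<^sup>2 = 4 * b * c * ?u * ?v"
      if "a \<noteq> 0" "b \<noteq> 0" "c \<noteq> 0" "C = triangle_conic a b c" for a b c
      using m1(1) double by (simp add: that tangent_triangle_conic cvec_def del: minus_add_distrib)
    have "solution_matrix (axis 1 1) (axis 2 1) (axis 3 1) m1 m2 C \<longleftrightarrow>
        (conic_matrix C \<and> det C \<noteq> 0 \<and> (\<forall>k. quad_form C (cvec (axis k 1)) = 0)) \<and>
        (\<forall>l\<in>{m1, m2}. quad_form (matrix_inv C) (cvec l) = 0)"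
      unfolding solution_matrix_def forall_3 by auto
    also have "\<dots> \<longleftrightarrow> (\<exists>a b c. (a \<noteq> 0 \<and> b \<noteq> 0 \<and> c \<noteq> 0 \<and> C = triangle_conic a b c) \<and>
        (\<forall>l\<in>{m1, m2}. quad_form (matrix_inv C) (cvec l) = 0))"
      unfolding circumscribed_iff by blast
    also have "\<dots> \<longleftrightarrow> ?M"
    proof (intro ex_cong1)
      fix a b c
      show "((a \<noteq> 0 \<and> b \<noteq> 0 \<and> c \<noteq> 0 \<and> C = triangle_conic a b c) \<and>
          (\<forall>l\<in>{m1, m2}. quad_form (matrix_inv C) (cvec l) = 0)) \<longleftrightarrow>
        (a \<noteq> 0 \<and> b \<noteq> 0 \<and> c \<noteq> 0 \<and> C = triangle_conic a b c \<and>
          c * ?u1 = b * ?v1 \<and> (?w * a - (c * ?u + b * ?v))\<^sup>2 = 4 * b * c * ?u * ?v)"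
        using tangents[of a b c] by argo
    qed
    finally show ?thesis .
  qed
  show ?thesis
    unfolding solution
  proof
    assume ?M
    then obtain a b c where abc: "a \<noteq> 0" "b \<noteq> 0" "c \<noteq> 0" "C = triangle_conic a b c"
      and l1: "c * ?u1 = b * ?v1" and l2: "(?w * a - (c * ?u + b * ?v))\<^sup>2 = 4 * b * c * ?u * ?v"
      by blast
    define s where "s = b / ?u1"
    have s: "s \<noteq> 0" "b = s * ?u1" "c = s * ?v1"
      using abc m1 l1 by (auto simp: s_def field_simps)
    define t where "t = a / s"
    have a: "a = s * t" using s by (simp add: t_def)
    have "s\<^sup>2 * (?w * t - (?v1 * ?u + ?u1 * ?v))\<^sup>2 = s\<^sup>2 * (4 * ?u1 * ?v1 * ?u * ?v)"
      using l2 unfolding s(2,3) a by (simp add: power2_eq_square algebra_simps)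
    then have "?Q t" using s(1) by simp
    moreover have "C = scale_mat s (triangle_conic t ?u1 ?v1)"
      by (simp add: abc scale_triangle_conic s a)
    ultimately show "\<exists>t s. s \<noteq> 0 \<and> ?Q t \<and> C = scale_mat s (triangle_conic t ?u1 ?v1)"
      using s(1) by blast
  next
    assume "\<exists>t s. s \<noteq> 0 \<and> ?Q t \<and> C = scale_mat s (triangle_conic t ?u1 ?v1)"
    then obtain t s where s: "s \<noteq> 0" and Q: "?Q t"
      and C: "C = triangle_conic (s * t) (s * ?u1) (s * ?v1)"
      by (auto simp: scale_triangle_conic)
    have "t \<noteq> 0"
    proof
      assume "t = 0"
      then have "(?v1 * ?u - ?u1 * ?v)\<^sup>2 = 0"
        using Q by (simp add: power2_eq_square algebra_simps)
      then have "complex_of_real (m1 $ 2 * m2 $ 1) = complex_of_real (m1 $ 1 * m2 $ 2)"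
        by simp
      then show False using ne of_real_eq_iff by blast
    qed
    moreover have "(?w * (s * t) - (s * ?v1 * ?u + s * ?u1 * ?v))\<^sup>2
        = 4 * (s * ?u1) * (s * ?v1) * ?u * ?v"
    proof -
      have "(?w * (s * t) - (s * ?v1 * ?u + s * ?u1 * ?v))\<^sup>2
          = s\<^sup>2 * (?w * t - (?v1 * ?u + ?u1 * ?v))\<^sup>2"
        by algebra
      also have "\<dots> = s\<^sup>2 * (4 * ?u1 * ?v1 * ?u * ?v)"
        using Q by simp
      finally show ?thesis by (simp add: power2_eq_square)
    qed
    ultimately show ?M
      using s m1 by (intro exI[of _ "s * t"] exI[of _ "s * ?u1"] exI[of _ "s * ?v1"]) (simp add: C)
  qed
qed

section \<open>Counting real solutions\<close>

text \<open>
  Counting conics as equivalence classes of matrices is reduced to counting the real parameters of a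
  normal form: by \<open>inj\<close> a class contains at most one normal form, and by \<open>real\<close> a real matrix in the
  class of a normal form forces its parameter to be real.
\<close>

lemma card_real_solution_conics:
  fixes f :: "complex \<Rightarrow> complex^3^3"
  assumes sol: "\<And>C. solution_matrix x1 x2 x3 l1 l2 C \<longleftrightarrow>
        (\<exists>t s. s \<noteq> 0 \<and> Q t \<and> C = scale_mat s (f t))"
    and inj: "\<And>t t' s. s \<noteq> 0 \<Longrightarrow> f t' = scale_mat s (f t) \<Longrightarrow> t' = t"
    and real: "\<And>t s R. s \<noteq> 0 \<Longrightarrow> cmat R = scale_mat s (f t) \<Longrightarrow> t \<in> \<real>"
    and real': "\<And>t. \<exists>R. f (complex_of_real t) = cmat R"
  shows "card {K \<in> solution_conics x1 x2 x3 l1 l2. real_conic K}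
    = card {t. Q (complex_of_real t)}"
proof -
  define k where "k t = conic_rel `` {f (complex_of_real t)}" for t
  have f_sol: "solution_matrix x1 x2 x3 l1 l2 (f t)" if "Q t" for t
  proof -
    have "f t = scale_mat 1 (f t)" by (simp add: vec_eq_iff)
    then show ?thesis unfolding sol using that one_neq_zero by blast
  qed
  then have f_conic: "conic_matrix (f t)" if "Q t" for t
    using that by (simp add: solution_matrix_def)
  have inj_k: "inj_on k {t. Q (complex_of_real t)}"
  proof (rule inj_onI, clarsimp)
    fix t t' assume Q: "Q (complex_of_real t)" "Q (complex_of_real t')" and "k t = k t'"
    then have "(f t, f t') \<in> conic_rel"
      using eq_equiv_class[OF _ equiv_conic_rel] f_conic unfolding k_def by blast
    then obtain c where "c \<noteq> 0" "f t' = scale_mat c (f t)"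
      by (auto simp: conic_rel_def)
    then show "t = t'"
      using inj of_real_eq_iff by metis
  qed
  have "{K \<in> solution_conics x1 x2 x3 l1 l2. real_conic K} = k ` {t. Q (complex_of_real t)}"
  proof (intro equalityI subsetI)
    fix K assume "K \<in> {K \<in> solution_conics x1 x2 x3 l1 l2. real_conic K}"
    then obtain C R where C: "solution_matrix x1 x2 x3 l1 l2 C" and K: "K = conic_rel `` {C}"
      and R: "cmat R \<in> K"
      by (auto simp: solution_conics_def real_conic_def elim!: quotientE)
    from C obtain t s where t: "s \<noteq> 0" "Q t" "C = scale_mat s (f t)"
      using sol by auto
    have rel: "(f t, C) \<in> conic_rel"
      using t f_conic C by (auto simp: conic_rel_def solution_matrix_def)
    then have K': "K = conic_rel `` {f t}"
      using K equiv_class_eq[OF equiv_conic_rel] by blast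
    with R obtain s' where "s' \<noteq> 0" "cmat R = scale_mat s' (f t)"
      by (auto simp: conic_rel_def)
    then obtain r where "t = complex_of_real r"
      using real Reals_cases by metis
    then show "K \<in> k ` {t. Q (complex_of_real t)}"
      using t(2) K' by (auto simp: k_def)
  next
    fix K assume "K \<in> k ` {t. Q (complex_of_real t)}"
    then obtain t where t: "Q (complex_of_real t)" "K = conic_rel `` {f t}"
      by (auto simp: k_def)
    then have "f t \<in> K"
      using equiv_class_self[OF equiv_conic_rel] f_conic by blast
    then have "real_conic K"
      using real'[of t] by (auto simp: real_conic_def)
    then show "K \<in> {K \<in> solution_conics x1 x2 x3 l1 l2. real_conic K}"
      using t f_sol by (auto simp: solution_conics_def intro: quotientI)
  qed
  then show ?thesis
    using card_image[OF inj_k] by simp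
qed

lemma card_real_square_roots_eq_2_iff:
  fixes w h d :: real
  assumes "w \<noteq> 0"
  shows "card {t. (w * t - h)\<^sup>2 = d} = 2 \<longleftrightarrow> 0 < d"
proof -
  have roots: "{t. (w * t - h)\<^sup>2 = d} = {(h + sqrt d) / w, (h + - sqrt d) / w}" if "0 \<le> d"
  proof -
    have "(w * t - h)\<^sup>2 = d \<longleftrightarrow> w * t - h = sqrt d \<or> w * t - h = - sqrt d" for t
      using power2_eq_iff[of "w * t - h" "sqrt d"] that by simp
    moreover have "w * t - h = e \<longleftrightarrow> t = (h + e) / w" for t e
      using assms by (auto simp: eq_divide_eq algebra_simps)
    ultimately show ?thesis by blast
  qed
  consider "d < 0" | "d = 0" | "0 < d" by linarith
  then show ?thesis
  proof cases
    case 1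
    then have "{t. (w * t - h)\<^sup>2 = d} = {}" using not_sum_power2_lt_zero by (auto simp: not_less)
    then show ?thesis using 1 by simp
  next
    case 2
    then show ?thesis using roots by simp
  next
    case 3
    then have "(h + sqrt d) / w \<noteq> (h + - sqrt d) / w"
      using assms by simp
    then show ?thesis using 3 roots by (simp add: card_insert_if)
  qed
qed

section \<open>Determinants and incidence\<close>

lemma det_of_columns: "det (of_columns a b c) = a \<bullet> cross3 b c"
  by (simp add: of_columns_def det_transpose dot_cross_det)

lemma of_columns_mult_axis:
  "of_columns a b c *v axis 1 1 = a" "of_columns a b c *v axis 2 1 = b"
  "of_columns a b c *v axis 3 1 = c"
  by (simp_all add: matrix_vector_mult_basis column_def of_columns_def transpose_def vec_eq_iff
      forall_3)

lemma transpose_of_columns_mult: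
  "(transpose (of_columns a b c) *v l) $ 1 = a \<bullet> l" "(transpose (of_columns a b c) *v l) $ 2 = b \<bullet> l"
  "(transpose (of_columns a b c) *v l) $ 3 = c \<bullet> l"
  by (simp_all add: of_columns_def matrix_vector_mul_component)

lemma proj_collinear_if_det_zero:
  assumes "det (of_columns a b c) = 0"
  shows "proj_collinear a b c"
proof -
  have "det (transpose (of_columns a b c)) = 0" using assms by (simp add: det_transpose)
  then obtain l where "l \<noteq> 0" "transpose (of_columns a b c) *v l = 0"
    using invertible_det_nz matrix_left_invertible_ker invertible_left_inverse by metis
  then show ?thesis
    using transpose_of_columns_mult[of a b c l] by (auto simp: proj_collinear_def incident_def)
qed

text \<open>The Binet--Cauchy identity.\<close>

lemma dot_cross_cross: "cross3 l m \<bullet> cross3 a b = (l \<bullet> a) * (m \<bullet> b) - (l \<bullet> b) * (m \<bullet> a)"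
  by (simp add: cross3_simps)

section \<open>Two real conics through three points and tangent to two lines\<close>

theorem proposition5:
  fixes x1 x2 x3 l1 l2 p :: "real^3"
  assumes "finite_point x1" and "finite_point x2" and "finite_point x3"
    and "l1 \<noteq> 0" and "l2 \<noteq> 0" and "\<not> same_proj l1 l2"
    and "general_position x1 x2 x3 l1 l2"
    and "x3 \<bullet> l1 = 0"
    and "p = cross3 l1 l2"
    and "\<not> proj_collinear x1 x2 p"
  shows "card {K \<in> solution_conics x1 x2 x3 l1 l2. real_conic K} = 2 \<longleftrightarrow>
    det (of_columns p x2 x3) * det (of_columns x1 p x3) * (x1 \<bullet> l2) * (x2 \<bullet> l2) < 0"
proof -
  define X where "X = of_columns x1 x2 x3"
  define m1 where "m1 = transpose X *v l1"
  define m2 where "m2 = transpose X *v l2"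
  have m1: "m1 $ 1 = x1 \<bullet> l1" "m1 $ 2 = x2 \<bullet> l1" "m1 $ 3 = 0"
    and m2: "m2 $ 1 = x1 \<bullet> l2" "m2 $ 2 = x2 \<bullet> l2" "m2 $ 3 = x3 \<bullet> l2"
    using assms(8) by (simp_all add: m1_def m2_def X_def transpose_of_columns_mult)
  have X: "det X \<noteq> 0"
    using assms(7) proj_collinear_if_det_zero by (auto simp: X_def general_position_def)
  have uv: "m1 $ 1 \<noteq> 0" "m1 $ 2 \<noteq> 0"
    using assms(7,8) by (auto simp: m1 general_position_def is_side_def incident_def)
  (* A cyclic shift moves p = l1 x l2 to the front of each determinant, which then is a scalar product
     of two cross products. *)
  have p12: "det (of_columns x1 x2 p) = m1 $ 1 * m2 $ 2 - m1 $ 2 * m2 $ 1"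
    and p23: "det (of_columns p x2 x3) = m1 $ 2 * m2 $ 3"
    and p13: "det (of_columns x1 p x3) = - (m1 $ 1 * m2 $ 3)"
  proof -
    have "det (of_columns x1 x2 p) = p \<bullet> cross3 x1 x2" "det (of_columns x1 p x3) = p \<bullet> cross3 x3 x1"
      unfolding det_of_columns by (simp_all add: cross3_simps)
    then show "det (of_columns x1 x2 p) = m1 $ 1 * m2 $ 2 - m1 $ 2 * m2 $ 1"
      "det (of_columns p x2 x3) = m1 $ 2 * m2 $ 3" "det (of_columns x1 p x3) = - (m1 $ 1 * m2 $ 3)"
      using assms(8) unfolding assms(9) m1 m2
      by (simp_all add: det_of_columns dot_cross_cross inner_commute algebra_simps)
  qed
  have ne: "m1 $ 2 * m2 $ 1 \<noteq> m1 $ 1 * m2 $ 2"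
    using assms(10) proj_collinear_if_det_zero p12 by fastforce
  have w: "m2 $ 3 \<noteq> 0"
  proof
    assume w: "m2 $ 3 = 0"
    (* Then both lines pass through x3, so their intersection point is the vertex x3. *)
    have "cross3 x3 p = 0"
      using assms(8) w by (simp add: assms(9) Lagrange m2)
    then have "collinear {0, p, x3}"
      by (simp add: cross_eq_0 insert_commute)
    moreover have "p \<noteq> 0" using p12 ne by (auto simp: det_of_columns)
    moreover have "x3 \<noteq> 0" using assms(3) by (auto simp: finite_point_def)
    ultimately have "same_proj p x3"
      by (auto simp: collinear_lemma same_proj_def)
    then show False
      using assms(7,9) by (simp add: general_position_def is_vertex_def)
  qed
  define Z where "Z = cmat (matrix_inv X)"
  have XZ: "cmat X ** Z = mat 1" "Z ** cmat X = mat 1"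
    using matrix_inv_mult[OF X] by (simp_all add: Z_def cmat_mult cmat_one)
  define Q where "Q t \<longleftrightarrow> (m2 $ 3 * t - (m1 $ 2 * m2 $ 1 + m1 $ 1 * m2 $ 2))\<^sup>2
        = complex_of_real (4 * m1 $ 1 * m1 $ 2 * m2 $ 1 * m2 $ 2)" for t :: complex
  define G where "G t = triangle_conic t (m1 $ 1) (m1 $ 2)" for t
  define f where "f t = congr Z (G t)" for t
  have f_iff: "C = scale_mat s (f t) \<longleftrightarrow> congr (cmat X) C = scale_mat s (G t)" for C s t
    unfolding f_def congr_scale[symmetric]
    using congr_cancel[OF XZ(1)] congr_cancel[OF XZ(2)] by metis
  have "card {K \<in> solution_conics x1 x2 x3 l1 l2. real_conic K} = card {t. Q (complex_of_real t)}"
  proof (rule card_real_solution_conics[where f = f])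
    show "solution_matrix x1 x2 x3 l1 l2 C \<longleftrightarrow> (\<exists>t s. s \<noteq> 0 \<and> Q t \<and> C = scale_mat s (f t))" for C
      using solution_matrix_congr[OF X, of "axis 1 1" "axis 2 1" "axis 3 1" l1 l2 C]
        solution_matrix_reference_triangle[OF m1(3) uv ne]
      unfolding f_iff Q_def G_def m1_def m2_def X_def of_columns_mult_axis by metis
  next
    fix t t' s assume "s \<noteq> 0" "f t' = scale_mat s (f t)"
    then have "G t' = scale_mat s (G t)"
      by (metis f_iff f_def congr_cancel XZ(2))
    then show "t' = t"
      using uv by (simp add: G_def scale_triangle_conic triangle_conic_eq_iff)
  next
    fix t s R assume s: "s \<noteq> 0" and "cmat R = scale_mat s (f t)"
    then have "cmat (transpose X ** R ** X) = scale_mat s (G t)"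
      using f_iff congr_cmat by metis
    then have "cmat (transpose X ** R ** X) $ 1 $ 2 = scale_mat s (G t) $ 1 $ 2"
      "cmat (transpose X ** R ** X) $ 1 $ 3 = scale_mat s (G t) $ 1 $ 3"
      by simp_all
    then have "s * t = complex_of_real ((transpose X ** R ** X) $ 1 $ 2)"
      "s * m1 $ 1 = complex_of_real ((transpose X ** R ** X) $ 1 $ 3)"
      by (simp_all add: G_def scale_triangle_conic triangle_conic_def)
    then have "s * t \<in> \<real>" "s * m1 $ 1 \<in> \<real>"
      by (simp_all only: Reals_of_real)
    (* The unknown scale s cancels in the ratio of two entries. *)
    then have "(s * t) / (s * m1 $ 1) * m1 $ 1 \<in> \<real>"
      by (blast intro: Reals_mult[OF Reals_divide] Reals_of_real)
    then show "t \<in> \<real>" using s uv by simp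
  next
    fix t :: real
    define T :: "real^3^3" where "T = vector [vector [0, t, m1 $ 1], vector [t, 0, m1 $ 2],
      vector [m1 $ 1, m1 $ 2, 0]]"
    have "cmat T = G t"
      by (simp add: T_def G_def triangle_conic_def vec_eq_iff forall_3)
    then show "\<exists>R. f (complex_of_real t) = cmat R"
      unfolding f_def Z_def by (metis congr_cmat)
  qed
  also have "{t. Q (complex_of_real t)} = {t. (m2 $ 3 * t - (m1 $ 2 * m2 $ 1 + m1 $ 1 * m2 $ 2))\<^sup>2
        = 4 * m1 $ 1 * m1 $ 2 * m2 $ 1 * m2 $ 2}"
    unfolding Q_def
    by (simp flip: of_real_mult of_real_diff of_real_add of_real_power
        del: of_real_mult of_real_diff of_real_add of_real_power)
  finally have "card {K \<in> solution_conics x1 x2 x3 l1 l2. real_conic K} = 2 \<longleftrightarrow>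
      0 < 4 * m1 $ 1 * m1 $ 2 * m2 $ 1 * m2 $ 2"
    using card_real_square_roots_eq_2_iff[OF w] by simp
  also have "\<dots> \<longleftrightarrow> det (of_columns p x2 x3) * det (of_columns x1 p x3) * (x1 \<bullet> l2) * (x2 \<bullet> l2) < 0"
  proof -
    have "det (of_columns p x2 x3) * det (of_columns x1 p x3) * (x1 \<bullet> l2) * (x2 \<bullet> l2)
        = - ((m2 $ 3)\<^sup>2 / 4 * (4 * m1 $ 1 * m1 $ 2 * m2 $ 1 * m2 $ 2))"
      by (simp add: p23 p13 power2_eq_square flip: m2)
    moreover have "0 < (m2 $ 3)\<^sup>2 / 4" using w by simp
    ultimately show ?thesis
      using mult_less_cancel_left_pos[of "(m2 $ 3)\<^sup>2 / 4" 0
          "4 * m1 $ 1 * m1 $ 2 * m2 $ 1 * m2 $ 2"]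
      by simp
  qed
  finally show ?thesis .
qed

end
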